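(* For every integer $n\ge 2$, the matroid $N_n$ obtained from the Catalan matroid $M_n$ by deleting the elements $1$ and $2n$ satisfies $$\max\{T_{N_n}(2,0),\,T_{N_n}(0,2)\}\ \ge\ T_{N_n}(1,1).$$
   Context: A Dyck path of length $2n$ is a path in the plane from $(0,0)$ to $(2n,0)$ with steps $(1,1)$ (up-steps) and $(1,-1)$ (down-steps) that never goes below the $x$-axis. The up-step set of a Dyck path $P$ is the set of $i$, $1\le i\le 2n$, such that the $i$-th step of $P$ is an up-step. The Catalan matroid $M_n$ is the matroid on $\{1,\dots,2n\}$ whose bases are the up-step sets of all Dyck paths of length $2n$. In $M_n$ the element $1$ is an isthmus (coloop) and $2n$ is a loop; $N_n=M_n\setminus\{1,2n\}$. For a matroid $M=(E,r)$, $T_M(x,y)=\sum_{A\subseteq E}(x-1)^{r(E)-r(A)}(y-1)^{|A|-r(A)}$ is the Tutte polynomial. *)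

theory Defs
  imports Main
begin

section \<open>Matroids\<close>

text \<open>
  A matroid is carried by its ground set together with its family of independent sets; the
  predicate \<open>is_matroid\<close> states the axioms for finite matroids.
\<close>

record 'a matroid =
  ground :: "'a set"
  indep :: "'a set \<Rightarrow> bool"

definition is_matroid :: "'a matroid \<Rightarrow> bool" where
  "is_matroid M \<longleftrightarrow>
     finite (ground M) \<and>
     (\<forall>X. indep M X \<longrightarrow> X \<subseteq> ground M) \<and>
     indep M {} \<and>
     (\<forall>X Y. indep M Y \<and> X \<subseteq> Y \<longrightarrow> indep M X) \<and>
     (\<forall>X Y. indep M X \<and> indep M Y \<and> card X < card Y \<longrightarrow> (\<exists>y\<in>Y - X. indep M (insert y X)))"

definition basis :: "'a matroid \<Rightarrow> 'a set \<Rightarrow> bool" where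
  "basis M B \<longleftrightarrow> indep M B \<and> (\<forall>X. indep M X \<and> B \<subseteq> X \<longrightarrow> X = B)"

definition matroid_rank :: "'a matroid \<Rightarrow> 'a set \<Rightarrow> nat" where
  "matroid_rank M A = Max {card X |X. X \<subseteq> A \<and> indep M X}"

definition deletion :: "'a matroid \<Rightarrow> 'a set \<Rightarrow> 'a matroid" where
  "deletion M D = \<lparr>ground = ground M - D, indep = (\<lambda>X. indep M X \<and> X \<inter> D = {})\<rparr>"

text \<open>
  In a matroid both exponents below are differences of natural numbers that do not truncate,
  and the convention \<open>0 ^ 0 = 1\<close> makes the sum the value of the Tutte polynomial at every point.
\<close>

definition tutte :: "'a matroid \<Rightarrow> 'b \<Rightarrow> 'b \<Rightarrow> 'b :: comm_ring_1" where
  "tutte M x y =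
     (\<Sum>A\<in>Pow (ground M).
        (x - 1) ^ (matroid_rank M (ground M) - matroid_rank M A) * (y - 1) ^ (card A - matroid_rank M A))"

section \<open>The Catalan matroid\<close>

text \<open>
  A lattice path is given by the list of the second coordinates of its steps: \<open>1\<close> stands for the
  up-step \<open>(1,1)\<close>, \<open>-1\<close> for the down-step \<open>(1,-1)\<close>.  Hence \<open>sum_list (take k s)\<close> is the height of
  the path after \<open>k\<close> steps.
\<close>

definition dyck_path :: "nat \<Rightarrow> int list \<Rightarrow> bool" where
  "dyck_path n s \<longleftrightarrow>
     length s = 2 * n \<and> set s \<subseteq> {1, -1} \<and>
     (\<forall>k\<le>2 * n. 0 \<le> sum_list (take k s)) \<and> sum_list s = 0"

text \<open>Steps are numbered from \<open>1\<close>, lists are indexed from \<open>0\<close>.\<close>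

definition up_steps :: "int list \<Rightarrow> nat set" where
  "up_steps s = {i \<in> {1..length s}. s ! (i - 1) = 1}"

text \<open>
  A set is independent iff it is contained in a basis, i.e. in the up-step set of a Dyck path;
  that this is a matroid with exactly the up-step sets as bases is shown in
  \<open>is_matroid_catalan\<close> and \<open>basis_catalan_iff\<close> below.
\<close>

definition catalan :: "nat \<Rightarrow> nat matroid" where
  "catalan n =
     \<lparr>ground = {1..2 * n}, indep = (\<lambda>X. \<exists>s. dyck_path n s \<and> X \<subseteq> up_steps s)\<rparr>"

definition catalan_deleted :: "nat \<Rightarrow> nat matroid" where
  "catalan_deleted n = deletion (catalan n) {1, 2 * n}"

section \<open>The definitions yield matroids\<close>

lemma is_matroid_deletion: "is_matroid (deletion M D)" if "is_matroid M"
  unfolding is_matroid_def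
proof (intro conjI allI impI)
  show "finite (ground (deletion M D))" "indep (deletion M D) {}"
    using that by (auto simp: is_matroid_def deletion_def)
  show "X \<subseteq> ground (deletion M D)" if "indep (deletion M D) X" for X
    using that \<open>is_matroid M\<close> by (auto simp: is_matroid_def deletion_def)
  have hered: "indep M X" if "indep M Y" "X \<subseteq> Y" for X Y
    using \<open>is_matroid M\<close>[unfolded is_matroid_def] that by (elim conjE) iprover
  show "indep (deletion M D) X" if "indep (deletion M D) Y \<and> X \<subseteq> Y" for X Y
    using that hered[of Y X] by (auto simp: deletion_def)
  fix X Y assume XY: "indep (deletion M D) X \<and> indep (deletion M D) Y \<and> card X < card Y"
  then have "indep M X \<and> indep M Y \<and> card X < card Y" by (simp add: deletion_def)
  moreover have "\<forall>X Y. indep M X \<and> indep M Y \<and> card X < card Y \<longrightarrow> (\<exists>y\<in>Y - X. indep M (insert y X))"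
    using \<open>is_matroid M\<close> by (simp add: is_matroid_def)
  ultimately obtain y where "y \<in> Y - X" "indep M (insert y X)" by blast
  with XY show "\<exists>y\<in>Y - X. indep (deletion M D) (insert y X)"
    by (auto simp: deletion_def)
qed

text \<open>An explicit description of the independent sets of the Catalan matroid.\<close>

definition ballot_set :: "nat \<Rightarrow> nat set \<Rightarrow> bool" where
  "ballot_set n X \<longleftrightarrow>
     X \<subseteq> {1..2 * n} \<and> (\<forall>k\<le>2 * n. 2 * card (X \<inter> {Suc k..2 * n}) + k \<le> 2 * n)"

lemma ballot_set_subset: "ballot_set n X" if "ballot_set n Y" "X \<subseteq> Y"
proof -
  have "card (X \<inter> {Suc k..2 * n}) \<le> card (Y \<inter> {Suc k..2 * n})" for k
    by (rule card_mono) (use that in auto)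
  then show ?thesis using that unfolding ballot_set_def
    by (meson add_le_mono1 le_trans mult_le_mono2 subset_trans)
qed

lemma card_split:
  fixes X :: "nat set"
  assumes "X \<subseteq> {1..m}" "k \<le> m"
  shows "card X = card (X \<inter> {1..k}) + card (X \<inter> {Suc k..m})"
proof -
  have "X = (X \<inter> {1..k}) \<union> (X \<inter> {Suc k..m})" using assms by auto
  also have "card \<dots> = card (X \<inter> {1..k}) + card (X \<inter> {Suc k..m})"
    by (rule card_Un_disjoint) auto
  finally show ?thesis .
qed

lemma ballot_set_augment:
  assumes X: "ballot_set n X" and Y: "ballot_set n Y" and lt: "card X < card Y"
  shows "\<exists>y\<in>Y - X. ballot_set n (insert y X)"
proof -
  define tight where
    "tight k \<longleftrightarrow> k \<le> 2 * n \<and> 2 * n < 2 * Suc (card (X \<inter> {Suc k..2 * n})) + k" for k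
  have "tight (2 * n)" by (simp add: tight_def)
  define k where "k = (LEAST k. tight k)"
  have k: "tight k" unfolding k_def by (rule LeastI) fact
  have least: "k \<le> j" if "tight j" for j unfolding k_def using that by (rule Least_le)
  have k2n: "k \<le> 2 * n" using k by (simp add: tight_def)
  have sub: "X \<subseteq> {1..2 * n}" "Y \<subseteq> {1..2 * n}" using X Y by (auto simp: ballot_set_def)
  have "2 * card (Y \<inter> {Suc k..2 * n}) + k \<le> 2 * n"
    using Y k2n by (auto simp: ballot_set_def)
  with k have "card (Y \<inter> {Suc k..2 * n}) \<le> card (X \<inter> {Suc k..2 * n})"
    by (simp add: tight_def)
  with lt card_split[OF sub(1) k2n] card_split[OF sub(2) k2n]
  have "card (X \<inter> {1..k}) < card (Y \<inter> {1..k})" by linarith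
  then have "\<not> Y \<inter> {1..k} \<subseteq> X \<inter> {1..k}"
    by (meson card_mono finite_Int finite_atLeastAtMost not_less)
  then obtain y where "y \<in> Y \<inter> {1..k}" "y \<notin> X \<inter> {1..k}" by blast
  then have y: "y \<in> Y" "y \<notin> X" "1 \<le> y" "y \<le> k" by auto
  have "2 * card (insert y X \<inter> {Suc j..2 * n}) + j \<le> 2 * n" if "j \<le> 2 * n" for j
  proof (cases "y \<le> j")
    case True
    then have "insert y X \<inter> {Suc j..2 * n} = X \<inter> {Suc j..2 * n}" by auto
    then show ?thesis using X that by (simp add: ballot_set_def)
  next
    case False
    then have "\<not> tight j" using least[of j] y by auto
    moreover have "card (insert y X \<inter> {Suc j..2 * n}) \<le> Suc (card (X \<inter> {Suc j..2 * n}))"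
    proof -
      have "card (insert y X \<inter> {Suc j..2 * n}) \<le> card (insert y (X \<inter> {Suc j..2 * n}))"
        by (rule card_mono) auto
      also have "\<dots> \<le> Suc (card (X \<inter> {Suc j..2 * n}))" by (simp add: card_insert_if)
      finally show ?thesis .
    qed
    ultimately show ?thesis using that by (auto simp: tight_def)
  qed
  then have "ballot_set n (insert y X)"
    using sub y by (auto simp: ballot_set_def)
  then show ?thesis using y by blast
qed

lemma ballot_set_card_le: "card X \<le> n" if "ballot_set n X"
proof -
  have "X \<inter> {Suc 0..2 * n} = X" using that by (auto simp: ballot_set_def)
  moreover have "2 * card (X \<inter> {Suc 0..2 * n}) + 0 \<le> 2 * n"
    using that unfolding ballot_set_def by blast
  ultimately show ?thesis by simp
qed

lemma ballot_set_finite: "finite X" if "ballot_set n X"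
  using that finite_subset by (auto simp: ballot_set_def)

lemma ballot_set_initial: "ballot_set n {1..n}"
proof -
  have "{1..n} \<inter> {Suc k..2 * n} = {Suc k..n}" for k by auto
  then show ?thesis by (auto simp: ballot_set_def)
qed

lemma ballot_set_extend:
  assumes "ballot_set n X"
  shows "\<exists>B. X \<subseteq> B \<and> ballot_set n B \<and> card B = n"
  using assms
proof (induction "n - card X" arbitrary: X)
  case 0
  then show ?case using ballot_set_card_le[of n X] by (intro exI[of _ X]) auto
next
  case (Suc d)
  have "card X < card {1..n}" using Suc.hyps(2) by simp
  then obtain y where y: "y \<notin> X" "ballot_set n (insert y X)"
    using ballot_set_augment[OF Suc.prems ballot_set_initial] by blast
  have "card (insert y X) = Suc (card X)"
    using y ballot_set_finite[OF Suc.prems] by simp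
  then have "d = n - card (insert y X)" using Suc.hyps(2) by simp
  from Suc.hyps(1)[OF this y(2)] show ?case by blast
qed

lemma sum_list_take_steps:
  assumes "set s \<subseteq> {1, -1}" "k \<le> length s"
  shows "sum_list (take k s) = 2 * int (card (up_steps s \<inter> {1..k})) - int k"
  using assms(2)
proof (induction k)
  case (Suc k)
  have *: "sum_list (take (Suc k) s) = sum_list (take k s) + s ! k"
    using Suc.prems by (simp add: take_Suc_conv_app_nth)
  have "s ! k \<in> {1, -1}" using Suc.prems assms(1) by (metis Suc_le_lessD nth_mem subsetD)
  then consider "s ! k = 1" | "s ! k = -1" by auto
  then show ?case
  proof cases
    case 1
    then have "up_steps s \<inter> {1..Suc k} = insert (Suc k) (up_steps s \<inter> {1..k})"
      using Suc.prems by (auto simp: up_steps_def le_Suc_eq)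
    then have "card (up_steps s \<inter> {1..Suc k}) = Suc (card (up_steps s \<inter> {1..k}))" by simp
    then show ?thesis using * 1 Suc by simp
  next
    case 2
    then have "up_steps s \<inter> {1..Suc k} = up_steps s \<inter> {1..k}"
      by (auto simp: up_steps_def le_Suc_eq)
    then show ?thesis using * 2 Suc by simp
  qed
qed simp

lemma up_steps_dyck:
  assumes "dyck_path n s"
  shows "ballot_set n (up_steps s)" and "card (up_steps s) = n"
proof -
  have s: "length s = 2 * n" "set s \<subseteq> {1, -1}" "\<And>k. k \<le> 2 * n \<Longrightarrow> 0 \<le> sum_list (take k s)"
    "sum_list s = 0" using assms by (auto simp: dyck_path_def)
  have sub: "up_steps s \<subseteq> {1..2 * n}" using s(1) by (auto simp: up_steps_def)
  then have "up_steps s \<inter> {1..2 * n} = up_steps s" by auto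
  with sum_list_take_steps[OF s(2), of "2 * n"] s(1,4)
  show card: "card (up_steps s) = n" by simp
  have "2 * card (up_steps s \<inter> {Suc k..2 * n}) + k \<le> 2 * n" if "k \<le> 2 * n" for k
    using s(3)[OF that] sum_list_take_steps[OF s(2), of k] that s(1) card
      card_split[OF sub that] by simp
  with sub show "ballot_set n (up_steps s)" by (simp add: ballot_set_def)
qed

lemma ballot_set_dyck:
  assumes "ballot_set n B" "card B = n"
  shows "\<exists>s. dyck_path n s \<and> up_steps s = B"
proof -
  define s :: "int list" where "s = map (\<lambda>i. if Suc i \<in> B then 1 else -1) [0..<2 * n]"
  have sub: "B \<subseteq> {1..2 * n}" using assms by (simp add: ballot_set_def)
  have len: "length s = 2 * n" and set: "set s \<subseteq> {1, -1}" by (auto simp: s_def)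
  have "x \<in> up_steps s \<longleftrightarrow> x \<in> B" for x
  proof (cases "x \<in> {1..2 * n}")
    case True
    then have "x - 1 < 2 * n" "Suc (x - 1) = x" by auto
    then have "s ! (x - 1) = (if x \<in> B then 1 else -1)" unfolding s_def by (subst nth_map) auto
    with True show ?thesis by (simp add: up_steps_def len)
  next
    case False
    then have "x \<notin> up_steps s" by (auto simp: up_steps_def len)
    moreover have "x \<notin> B" using False sub by blast
    ultimately show ?thesis by simp
  qed
  then have up: "up_steps s = B" by blast
  have "0 \<le> sum_list (take k s)" if "k \<le> 2 * n" for k
  proof -
    have "2 * card (B \<inter> {Suc k..2 * n}) + k \<le> 2 * n"
      using assms that by (simp add: ballot_set_def)
    then show ?thesis
      using sum_list_take_steps[OF set, of k] card_split[OF sub that] that len up assms(2) by simp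
  qed
  moreover have "sum_list s = 0"
  proof -
    have "B \<inter> {1..2 * n} = B" using sub by auto
    then show ?thesis using sum_list_take_steps[OF set, of "2 * n"] len up assms(2) by simp
  qed
  ultimately show ?thesis using len set up by (auto simp: dyck_path_def)
qed

lemma indep_catalan_iff: "indep (catalan n) X \<longleftrightarrow> ballot_set n X"
proof
  assume "indep (catalan n) X"
  then show "ballot_set n X"
    by (auto simp: catalan_def intro: ballot_set_subset[OF up_steps_dyck(1)])
next
  assume "ballot_set n X"
  then show "indep (catalan n) X"
    using ballot_set_extend ballot_set_dyck by (fastforce simp: catalan_def)
qed

lemma is_matroid_catalan: "is_matroid (catalan n)"
  unfolding is_matroid_def indep_catalan_iff
proof (intro conjI allI impI)
  show "finite (ground (catalan n))" by (simp add: catalan_def)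
  show "X \<subseteq> ground (catalan n)" if "ballot_set n X" for X
    using that by (simp add: catalan_def ballot_set_def)
  show "ballot_set n {}" by (simp add: ballot_set_def)
  show "ballot_set n X" if "ballot_set n Y \<and> X \<subseteq> Y" for X Y
    using that ballot_set_subset[of n Y X] by simp
  show "\<exists>y\<in>Y - X. ballot_set n (insert y X)"
    if "ballot_set n X \<and> ballot_set n Y \<and> card X < card Y" for X Y
    using that ballot_set_augment[of n X Y] by simp
qed

lemma basis_catalan_iff: "basis (catalan n) B \<longleftrightarrow> (\<exists>s. dyck_path n s \<and> B = up_steps s)"
proof
  assume B: "basis (catalan n) B"
  then obtain s where s: "dyck_path n s" "B \<subseteq> up_steps s"
    by (auto simp: basis_def catalan_def)
  then have "indep (catalan n) (up_steps s)" by (auto simp: catalan_def)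
  with B s show "\<exists>s. dyck_path n s \<and> B = up_steps s" unfolding basis_def by blast
next
  assume "\<exists>s. dyck_path n s \<and> B = up_steps s"
  then obtain s where s: "dyck_path n s" "B = up_steps s" by blast
  have "X = B" if "ballot_set n X" "B \<subseteq> X" for X
    using that s up_steps_dyck[OF s(1)] ballot_set_card_le[OF that(1)] ballot_set_finite[OF that(1)]
    by (metis card_seteq)
  then show "basis (catalan n) B"
    using s up_steps_dyck(1) by (auto simp: basis_def indep_catalan_iff)
qed

lemma is_matroid_catalan_deleted: "is_matroid (catalan_deleted n)"
  by (simp add: catalan_deleted_def is_matroid_deletion is_matroid_catalan)

end

theory Submission
  imports Defs
begin

text \<open>
  Already \<open>T(2,0) \<ge> T(1,1)\<close>.  Let \<open>h k = 2 * n - k - 2 * |A \<inter> {k<..2 * n}|\<close> be the height of the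
  walk read from right to left.  In \<open>T(2,0) = \<Sum> (-1) ^ (|A| - r A)\<close> consider the largest
  \<open>k \<ge> 2\<close>, \<open>k < 2 * n\<close>, with \<open>h k = 0\<close>: the elements of \<open>A\<close> above \<open>k\<close> span \<open>k\<close>, so that toggling
  \<open>k\<close> reverses the sign.  What remains are the sets whose height is positive at all these \<open>k\<close>.
  They are independent, and each contributes \<open>1\<close>.  Deleting \<open>2\<close> from a basis and shifting it down
  by one maps the bases, which are counted by \<open>T(1,1)\<close>, injectively to such sets.
\<close>

section \<open>Rank and the Tutte polynomial at special points\<close>

lemma finite_card_indep_subsets: "finite {card X |X. X \<subseteq> A \<and> indep M X}" if "finite A"
proof -
  have "{card X |X. X \<subseteq> A \<and> indep M X} \<subseteq> card ` Pow A" by auto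
  then show ?thesis using that by (meson finite_Pow_iff finite_imageI finite_subset)
qed

lemma matroid_rank_attained:
  assumes "is_matroid M" "finite A"
  obtains X where "X \<subseteq> A" "indep M X" "card X = matroid_rank M A"
proof -
  have "{card X |X. X \<subseteq> A \<and> indep M X} \<noteq> {}"
    using assms(1) by (auto simp: is_matroid_def)
  from Max_in[OF finite_card_indep_subsets[OF assms(2)] this] that show thesis
    by (auto simp: matroid_rank_def)
qed

lemma card_le_matroid_rank:
  assumes "finite A" "X \<subseteq> A" "indep M X"
  shows "card X \<le> matroid_rank M A"
  unfolding matroid_rank_def
  by (rule Max_ge[OF finite_card_indep_subsets[OF assms(1)]]) (use assms in auto)

lemma matroid_rank_le_card:
  assumes "is_matroid M" "finite A"
  shows "matroid_rank M A \<le> card A"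
  by (metis assms card_mono matroid_rank_attained)

lemma indep_iff_matroid_rank:
  assumes "is_matroid M" "finite A"
  shows "indep M A \<longleftrightarrow> matroid_rank M A = card A"
  by (metis assms card_le_matroid_rank card_subset_eq le_antisym matroid_rank_attained
      matroid_rank_le_card subset_refl)

text \<open>Since \<open>0 ^ 0 = 1\<close>, only sets with both exponents zero contribute. As
  subtraction truncates, this says that the rank of \<open>A\<close> is at least that of the ground
  set and at least \<open>card A\<close>, which singles out the bases.\<close>

lemma tutte_1_1:
  assumes "is_matroid M"
  shows "tutte M 1 1
    = of_nat (card {B. indep M B \<and> card B = matroid_rank M (ground M)})"
proof -
  let ?E = "ground M"
  have fin: "finite ?E" and ind: "\<And>X. indep M X \<Longrightarrow> X \<subseteq> ?E"
    using assms by (auto simp: is_matroid_def)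
  let ?S = "{B. indep M B \<and> card B = matroid_rank M ?E}"
  have sub: "?S \<subseteq> Pow ?E" using ind by auto
  have "(1 - 1) ^ (matroid_rank M ?E - matroid_rank M A) * (1 - 1) ^ (card A - matroid_rank M A)
      = (if A \<in> ?S then 1 else 0 :: 'b)" if "A \<in> Pow ?E" for A
  proof -
    have finA: "finite A" using that fin finite_subset by auto
    have "A \<in> ?S \<longleftrightarrow> matroid_rank M ?E \<le> matroid_rank M A \<and> card A \<le> matroid_rank M A"
    proof
      assume "A \<in> ?S"
      then show "matroid_rank M ?E \<le> matroid_rank M A \<and> card A \<le> matroid_rank M A"
        using indep_iff_matroid_rank[OF assms finA] by auto
    next
      assume *: "matroid_rank M ?E \<le> matroid_rank M A \<and> card A \<le> matroid_rank M A"
      then have i: "indep M A"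
        using indep_iff_matroid_rank[OF assms finA] matroid_rank_le_card[OF assms finA] by simp
      moreover have "card A \<le> matroid_rank M ?E"
        using card_le_matroid_rank[OF fin _ i] that by auto
      ultimately show "A \<in> ?S"
        using * indep_iff_matroid_rank[OF assms finA] by simp
    qed
    then show ?thesis by (auto simp: power_0_left)
  qed
  then have "tutte M 1 1 = (\<Sum>A\<in>Pow ?E. if A \<in> ?S then 1 else 0 :: 'b)"
    unfolding tutte_def by (intro sum.cong) auto
  also have "\<dots> = of_nat (card (Pow ?E \<inter> ?S))"
    using fin by (simp add: sum.If_cases)
  also have "Pow ?E \<inter> ?S = ?S" using sub by blast
  finally show ?thesis .
qed

text \<open>This is the summand of \<open>T(2,0)\<close>: there the corank factor is a power of
  \<open>2 - 1 = 1\<close>.\<close>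

definition nullity_sign :: "'a matroid \<Rightarrow> 'a set \<Rightarrow> int" where
  "nullity_sign M A = (-1) ^ (card A - matroid_rank M A)"

lemma tutte_2_0: "tutte M 2 0 = (\<Sum>A\<in>Pow (ground M). nullity_sign M A)"
  by (simp add: tutte_def nullity_sign_def)

lemma nullity_sign_indep:
  assumes "is_matroid M" "indep M A" "finite A"
  shows "nullity_sign M A = 1"
  using assms indep_iff_matroid_rank[of M A] by (simp add: nullity_sign_def)

text \<open>The nullity grows by one, because the cardinality does and the rank does not.\<close>

lemma nullity_sign_insert:
  assumes M: "is_matroid M" and "finite A" "k \<notin> A"
    and rank: "matroid_rank M (insert k A) = matroid_rank M A"
  shows "nullity_sign M (insert k A) = - nullity_sign M A"
  using assms matroid_rank_le_card[OF M \<open>finite A\<close>]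
  by (simp add: nullity_sign_def Suc_diff_le)

text \<open>Only independent sets through \<open>k\<close> have to be traded for equally large ones
  inside \<open>A\<close>; then both maxima are taken over the same set of cardinalities.\<close>

lemma matroid_rank_insert_eqI:
  assumes "\<And>X. \<lbrakk>X \<subseteq> insert k A; indep M X; k \<in> X\<rbrakk>
    \<Longrightarrow> \<exists>Y\<subseteq>A. indep M Y \<and> card Y = card X"
  shows "matroid_rank M (insert k A) = matroid_rank M A"
proof -
  have "\<exists>Y\<subseteq>A. indep M Y \<and> card Y = card X" if "X \<subseteq> insert k A" "indep M X" for X
    using assms[of X] that by (cases "k \<in> X") auto
  then have "{card X |X. X \<subseteq> insert k A \<and> indep M X} = {card X |X. X \<subseteq> A \<and> indep M X}"
    by (smt (verit) Collect_cong subset_insertI2)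
  then show ?thesis by (simp add: matroid_rank_def)
qed

section \<open>The first return to height zero\<close>

lemma ground_catalan_deleted: "ground (catalan_deleted n) = {2..<2 * n}"
  by (auto simp: catalan_deleted_def catalan_def deletion_def)

lemma indep_catalan_deleted_iff:
  "indep (catalan_deleted n) X \<longleftrightarrow> ballot_set n X \<and> X \<subseteq> {2..<2 * n}"
proof -
  have "X \<inter> {1, 2 * n} = {} \<longleftrightarrow> X \<subseteq> {2..<2 * n}" if "X \<subseteq> {1..2 * n}"
  proof -
    have "{1..2 * n} - {1, 2 * n} = {2..<2 * n}" by auto
    then show ?thesis using that by blast
  qed
  then show ?thesis
    unfolding catalan_deleted_def deletion_def by (auto simp: indep_catalan_iff ballot_set_def)
qed

text \<open>This is \<open>h k \<le> 0\<close>, written without subtraction; for arbitrary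
  \<open>A\<close> the height may be negative. The range is the ground set, so that \<open>k\<close>
  can be toggled; it leaves out \<open>2 * n\<close>, where the height is always
  \<open>0\<close>.\<close>

definition blocked_at :: "nat \<Rightarrow> nat set \<Rightarrow> nat \<Rightarrow> bool" where
  "blocked_at n A k \<longleftrightarrow> k \<in> {2..<2 * n} \<and> 2 * n \<le> 2 * card (A \<inter> {Suc k..2 * n}) + k"

definition last_blocked :: "nat \<Rightarrow> nat set \<Rightarrow> nat \<Rightarrow> bool" where
  "last_blocked n A k \<longleftrightarrow> blocked_at n A k \<and> (\<forall>j>k. \<not> blocked_at n A j)"

lemma last_blocked_exists: "\<exists>k. last_blocked n A k" if "blocked_at n A k"
proof -
  let ?S = "{k. blocked_at n A k}"
  have fin: "finite ?S" by (rule finite_subset[of _ "{2..<2 * n}"]) (auto simp: blocked_at_def)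
  have "Max ?S \<in> ?S" using Max_in[OF fin] that by auto
  moreover have "\<not> blocked_at n A j" if "j > Max ?S" for j
    using Max_ge[OF fin, of j] that by auto
  ultimately show ?thesis by (auto simp: last_blocked_def)
qed

lemma last_blocked_unique: "j = k" if "last_blocked n A j" "last_blocked n A k"
  using that by (meson last_blocked_def linorder_neqE_nat)

text \<open>Heights at \<open>k\<close> and beyond see only elements above \<open>k\<close>, so
  toggling \<open>k\<close> itself keeps it the last blocked position.\<close>

lemma last_blocked_cong:
  assumes "A \<inter> {k<..} = B \<inter> {k<..}"
  shows "last_blocked n A k \<longleftrightarrow> last_blocked n B k"
proof -
  have "A \<inter> {Suc j..2 * n} = B \<inter> {Suc j..2 * n}" if "j \<ge> k" for j
  proof -
    have "C \<inter> {Suc j..2 * n} = C \<inter> {k<..} \<inter> {Suc j..2 * n}" for C using that by auto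
    then show ?thesis using assms by metis
  qed
  then have "blocked_at n A j \<longleftrightarrow> blocked_at n B j" if "j \<ge> k" for j
    using that by (simp add: blocked_at_def)
  then show ?thesis by (auto simp: last_blocked_def)
qed

text \<open>The elements of \<open>A\<close> above the last blocked position \<open>k\<close> span \<open>k\<close>.\<close>

lemma matroid_rank_insert_last_blocked:
  assumes k: "last_blocked n A k" and A: "A \<subseteq> {2..<2 * n}"
  shows "matroid_rank (catalan_deleted n) (insert k (A - {k}))
    = matroid_rank (catalan_deleted n) (A - {k})"
proof (rule matroid_rank_insert_eqI, unfold indep_catalan_deleted_iff)
  fix X assume X: "X \<subseteq> insert k (A - {k})" "ballot_set n X \<and> X \<subseteq> {2..<2 * n}" "k \<in> X"
  have kn: "2 \<le> k" "k < 2 * n" and full: "2 * n \<le> 2 * card (A \<inter> {Suc k..2 * n}) + k"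
    using k by (auto simp: last_blocked_def blocked_at_def)
  let ?X = "X \<inter> {Suc k..2 * n}" and ?A = "A \<inter> {Suc k..2 * n}"
  have above: "2 * card (A \<inter> {Suc j..2 * n}) + j \<le> 2 * n" if "k < j" "j \<le> 2 * n" for j
  proof (cases "j = 2 * n")
    case False
    have "\<not> blocked_at n A j" using k that by (auto simp: last_blocked_def)
    then show ?thesis using False that kn by (auto simp: blocked_at_def)
  qed simp
  \<comment> \<open>Consecutive heights differ by one; being positive at \<open>Suc k\<close> and at
    most \<open>0\<close> at \<open>k\<close>, the height vanishes at \<open>k\<close>.\<close>
  have eq: "2 * card ?A + k = 2 * n"
  proof -
    have "card ?A \<le> card (insert (Suc k) (A \<inter> {Suc (Suc k)..2 * n}))"
      by (rule card_mono) (auto simp: Suc_le_eq le_eq_less_or_eq)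
    also have "\<dots> \<le> Suc (card (A \<inter> {Suc (Suc k)..2 * n}))" by (simp add: card_insert_if)
    finally have step: "card ?A \<le> Suc (card (A \<inter> {Suc (Suc k)..2 * n}))" .
    have "\<not> blocked_at n A (Suc k)" using k by (simp add: last_blocked_def)
    \<comment> \<open>For \<open>k = 2 * n - 1\<close> no element of \<open>A\<close> lies above
      \<open>k\<close>, and the height would be \<open>1\<close>.\<close>
    moreover have "Suc k < 2 * n"
    proof (rule ccontr)
      assume "\<not> Suc k < 2 * n"
      then have "?A = {}" using A kn by force
      then show False using full kn by simp
    qed
    ultimately have "2 * card (A \<inter> {Suc (Suc k)..2 * n}) + Suc k < 2 * n"
      using kn by (simp add: blocked_at_def)
    then show ?thesis using step full by linarith
  qed
  have "ballot_set n ?A"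
    unfolding ballot_set_def
  proof (intro conjI allI impI)
    fix j assume j: "j \<le> 2 * n"
    show "2 * card (?A \<inter> {Suc j..2 * n}) + j \<le> 2 * n"
    proof (cases "j \<le> k")
      case True
      then have "?A \<inter> {Suc j..2 * n} = ?A" by auto
      then show ?thesis using eq True by simp
    next
      case False
      then have "?A \<inter> {Suc j..2 * n} = A \<inter> {Suc j..2 * n}" by auto
      then show ?thesis using above[of j] False j by simp
    qed
  qed auto
  moreover have "ballot_set n ?X" using X ballot_set_subset[of n X ?X] by blast
  \<comment> \<open>At \<open>k - 1\<close> the independence of \<open>X\<close> counts
    \<open>k\<close> too:
    \<open>2 * (card ?X + 1) + (k - 1) \<le> 2 * n = 2 * card ?A + k\<close>.\<close>
  moreover have "card ?X < card ?A"
  proof -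
    have "X \<inter> {k..2 * n} = insert k ?X" using X kn by (auto simp: Suc_le_eq le_eq_less_or_eq)
    then have "card (X \<inter> {k..2 * n}) = Suc (card ?X)" by simp
    moreover have "2 * card (X \<inter> {Suc (k - 1)..2 * n}) + (k - 1) \<le> 2 * n"
      using X kn unfolding ballot_set_def by (metis le_diff_conv less_imp_le_nat trans_le_add1)
    ultimately show ?thesis using eq kn by simp
  qed
  ultimately obtain y where y: "y \<in> ?A - ?X" "ballot_set n (insert y ?X)"
    using ballot_set_augment by blast
  \<comment> \<open>The element \<open>k\<close> is exchanged for \<open>y\<close>. For
    \<open>j < k\<close> both lie above \<open>j\<close> and the count is unchanged; for
    \<open>j \<ge> k\<close> the set agrees above \<open>j\<close> with the independent set
    \<open>insert y ?X\<close>.\<close>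
  let ?Y = "insert y (X - {k})"
  have finX: "finite X" using X ballot_set_finite by blast
  have "2 * card (?Y \<inter> {Suc j..2 * n}) + j \<le> 2 * n" if j: "j \<le> 2 * n" for j
  proof (cases "j < k")
    case True
    then have "?Y \<inter> {Suc j..2 * n} = insert y (X \<inter> {Suc j..2 * n} - {k})" using y by auto
    moreover have "k \<in> X \<inter> {Suc j..2 * n}" "y \<notin> X \<inter> {Suc j..2 * n}" using X y True kn by auto
    ultimately have "card (?Y \<inter> {Suc j..2 * n}) = card (X \<inter> {Suc j..2 * n})"
      by (metis card_insert_disjoint finX finite_Diff finite_Int insert_Diff insertCI Diff_iff)
    then show ?thesis using X j by (simp add: ballot_set_def)
  next
    case False
    then have "?Y \<inter> {Suc j..2 * n} = insert y ?X \<inter> {Suc j..2 * n}" by auto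
    then show ?thesis using y j by (simp add: ballot_set_def)
  qed
  moreover have "?Y \<subseteq> {1..2 * n}" using X(2) y(1) by auto
  ultimately have "ballot_set n ?Y" by (simp add: ballot_set_def)
  moreover have "card ?Y = card X"
  proof -
    have "y \<notin> X - {k}" using y by auto
    then show ?thesis using finX X(3) by (metis card_Suc_Diff1 card_insert_disjoint finite_Diff)
  qed
  moreover have "?Y \<subseteq> A - {k}" using X y by auto
  ultimately show "\<exists>Y\<subseteq>A - {k}. (ballot_set n Y \<and> Y \<subseteq> {2..<2 * n}) \<and> card Y = card X"
    using A by blast
qed

section \<open>Cancellation and the surviving sets\<close>

definition unblocked_sets :: "nat \<Rightarrow> nat set set" where
  "unblocked_sets n = {A. A \<subseteq> {2..<2 * n} \<and> (\<forall>k. \<not> blocked_at n A k)}"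

text \<open>The positions \<open>0\<close>, \<open>1\<close> and \<open>2 * n\<close> remain. At
  \<open>2 * n\<close> the height is \<open>0\<close>; \<open>h 2 > 0\<close> gives
  \<open>h 1 \<ge> 0\<close>, and \<open>h 0 = h 1 + 1\<close> as \<open>1\<close> is not in
  \<open>A\<close>. For \<open>n \<le> 1\<close> the ground set is empty.\<close>

lemma unblocked_sets_indep: "indep (catalan_deleted n) A" if "A \<in> unblocked_sets n"
proof -
  have sub: "A \<subseteq> {2..<2 * n}" and un: "\<not> blocked_at n A k" for k
    using that by (auto simp: unblocked_sets_def)
  have above: "2 * card (A \<inter> {Suc k..2 * n}) + k < 2 * n" if "k \<in> {2..<2 * n}" for k
    using un[of k] that by (simp add: blocked_at_def not_le)
  have "2 * card (A \<inter> {Suc k..2 * n}) + k \<le> 2 * n" if k: "k \<le> 2 * n" for k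
  proof (cases "k \<in> {2..<2 * n}")
    case True
    then show ?thesis using above less_imp_le by blast
  next
    case False
    then consider "k = 2 * n" | "k \<le> 1" "n \<le> 1" | "k \<le> 1" "2 \<le> n" using k by force
    then show ?thesis
    proof cases
      case 2
      then have "A = {}" using sub by auto
      then show ?thesis using k by simp
    next
      case 3
      have "card (A \<inter> {Suc k..2 * n}) \<le> card (insert 2 (A \<inter> {Suc 2..2 * n}))"
        by (rule card_mono) (use sub in auto)
      also have "\<dots> \<le> Suc (card (A \<inter> {Suc 2..2 * n}))" by (simp add: card_insert_if)
      finally show ?thesis using above[of 2] 3 by simp
    qed simp
  qed
  with sub have "ballot_set n A" unfolding ballot_set_def by fastforce
  with sub show ?thesis by (simp add: indep_catalan_deleted_iff)
qed

lemma tutte_2_0_catalan_deleted: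
  "tutte (catalan_deleted n) 2 0 = int (card (unblocked_sets n))"
proof -
  let ?M = "catalan_deleted n" and ?P = "Pow {2..<2 * n}"
  let ?s = "nullity_sign ?M"
  let ?bad = "?P - unblocked_sets n"
  \<comment> \<open>\<open>THE\<close> is meaningful only on \<open>?bad\<close>, where existence
    and uniqueness hold; \<open>f\<close> is used only there.\<close>
  define c where "c A = (THE k. last_blocked n A k)" for A
  define f where "f A = (if c A \<in> A then A - {c A} else insert (c A) A)" for A
  note M = is_matroid_catalan_deleted[of n]
  have c: "last_blocked n A (c A)" if "A \<in> ?bad" for A
  proof -
    obtain k where "blocked_at n A k" using \<open>A \<in> ?bad\<close> by (auto simp: unblocked_sets_def)
    then obtain k where "last_blocked n A k" using last_blocked_exists by blast
    then show ?thesis unfolding c_def by (metis last_blocked_unique the_equality)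
  qed
  have f: "f A \<in> ?bad" "f (f A) = A" "?s (f A) = - ?s A" if A: "A \<in> ?bad" for A
  proof -
    have k: "last_blocked n A (c A)" using c[OF A] .
    have "A \<inter> {c A<..} = f A \<inter> {c A<..}" by (auto simp: f_def)
    then have fk: "last_blocked n (f A) (c A)" using k last_blocked_cong by blast
    have kin: "c A \<in> {2..<2 * n}" using k by (auto simp: last_blocked_def blocked_at_def)
    have sub: "A \<subseteq> {2..<2 * n}" using A by auto
    have "f A \<subseteq> {2..<2 * n}" using sub kin by (auto simp: f_def)
    then show bad: "f A \<in> ?bad" using fk by (auto simp: unblocked_sets_def last_blocked_def)
    have "c (f A) = c A" using last_blocked_unique[OF c[OF bad] fk] .
    then show "f (f A) = A" unfolding f_def[of "f A"] by (auto simp: f_def)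
    \<comment> \<open>One identity serves both directions of the toggle: the two sets are
      \<open>A\<close> and \<open>f A\<close> in some order.\<close>
    have "?s (insert (c A) (A - {c A})) = - ?s (A - {c A})"
      by (rule nullity_sign_insert[OF M _ _ matroid_rank_insert_last_blocked[OF k sub]])
        (use sub finite_subset in auto)
    then show "?s (f A) = - ?s A" by (auto simp: f_def insert_absorb)
  qed
  \<comment> \<open>Reindexing along the involution \<open>f\<close> shows that the sum equals its
    own negative.\<close>
  have "sum ?s ?bad = (\<Sum>A\<in>?bad. - ?s A)"
    by (rule sum.reindex_bij_witness[of _ f f]) (use f in auto)
  then have "sum ?s ?bad = 0" by (simp add: sum_negf)
  moreover have "sum ?s (unblocked_sets n) = (\<Sum>A\<in>unblocked_sets n. 1)"
  proof (rule sum.cong)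
    fix A assume A: "A \<in> unblocked_sets n"
    then have "finite A" using finite_subset by (auto simp: unblocked_sets_def)
    then show "?s A = 1" using nullity_sign_indep[OF M unblocked_sets_indep[OF A]] by simp
  qed simp
  moreover have "sum ?s ?P = sum ?s ?bad + sum ?s (unblocked_sets n)"
    by (rule sum.subset_diff) (auto simp: unblocked_sets_def)
  ultimately show ?thesis by (simp add: tutte_2_0 ground_catalan_deleted)
qed

section \<open>Shifting bases\<close>

text \<open>Elements of the image above \<open>k\<close> come from elements of \<open>B\<close>
  above \<open>k + 1\<close>. Hence its height at \<open>k\<close> exceeds the nonnegative height of
  \<open>B\<close> at \<open>k + 1\<close> by at least one. The element \<open>2\<close> is dropped
  because it would move to \<open>1\<close>, outside the ground set.\<close>

lemma shift_indep_unblocked: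
  assumes "indep (catalan_deleted n) B"
  shows "(\<lambda>i. i - 1) ` (B - {2}) \<in> unblocked_sets n"
proof -
  let ?C = "(\<lambda>i. i - 1) ` (B - {2})"
  have B: "ballot_set n B" "B \<subseteq> {2..<2 * n}"
    using assms by (auto simp: indep_catalan_deleted_iff)
  have "\<not> blocked_at n ?C k" for k
  proof
    assume "blocked_at n ?C k"
    then have k: "2 \<le> k" "k < 2 * n" and full: "2 * n \<le> 2 * card (?C \<inter> {Suc k..2 * n}) + k"
      by (auto simp: blocked_at_def)
    have "?C \<inter> {Suc k..2 * n} \<subseteq> (\<lambda>i. i - 1) ` (B \<inter> {Suc (Suc k)..2 * n})"
      using B(2) by fastforce
    then have "card (?C \<inter> {Suc k..2 * n}) \<le> card (B \<inter> {Suc (Suc k)..2 * n})"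
      using surj_card_le[of "B \<inter> {Suc (Suc k)..2 * n}"] by simp
    moreover have "2 * card (B \<inter> {Suc (Suc k)..2 * n}) + Suc k \<le> 2 * n"
      using B(1) k unfolding ballot_set_def by (meson Suc_leI)
    ultimately show False using full by simp
  qed
  moreover have "?C \<subseteq> {2..<2 * n}" using B(2) by fastforce
  ultimately show ?thesis by (simp add: unblocked_sets_def)
qed

text \<open>The lost information, whether \<open>2 \<in> B\<close>, is recovered from the size of \<open>B\<close>.\<close>

lemma inj_on_shift:
  "inj_on (\<lambda>B. (\<lambda>i. i - 1) ` (B - {2})) {B. indep (catalan_deleted n) B \<and> card B = r}"
proof (rule inj_onI)
  fix B C assume "B \<in> {B. indep (catalan_deleted n) B \<and> card B = r}"
    and "C \<in> {B. indep (catalan_deleted n) B \<and> card B = r}"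
    and img: "(\<lambda>i. i - 1) ` (B - {2}) = (\<lambda>i. i - 1) ` (C - {2})"
  then have sub: "B \<subseteq> {2..<2 * n}" "C \<subseteq> {2..<2 * n}" and card: "card B = card C"
    by (auto simp: indep_catalan_deleted_iff)
  have "inj_on (\<lambda>i. i - 1) {2..<2 * n}" by (auto simp: inj_on_def)
  then have eq: "B - {2} = C - {2}"
    using img inj_on_image_eq_iff[of "\<lambda>i. i - 1" "{2..<2 * n}" "B - {2}" "C - {2}"] sub by blast
  have fin: "finite B" "finite C" using sub finite_subset by auto
  show "B = C"
  proof (cases "2 \<in> B \<longleftrightarrow> 2 \<in> C")
    case True
    then show ?thesis using eq by blast
  next
    case False
    then show ?thesis
      using eq card fin by (metis Diff_empty Diff_insert0 card_Suc_Diff1 n_not_Suc_n)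
  qed
qed

theorem theorem5p7:
  fixes n :: nat
  assumes "n \<ge> 2"
  shows "max (tutte (catalan_deleted n) 2 0) (tutte (catalan_deleted n) 0 2)
           \<ge> tutte (catalan_deleted n) 1 (1 :: int)"
proof -
  let ?M = "catalan_deleted n"
  let ?S = "{B. indep ?M B \<and> card B = matroid_rank ?M (ground ?M)}"
  have "finite (unblocked_sets n)"
    by (rule finite_subset[of _ "Pow {2..<2 * n}"]) (auto simp: unblocked_sets_def)
  then have "card ?S \<le> card (unblocked_sets n)"
    by (intro card_inj_on_le[OF inj_on_shift]) (use shift_indep_unblocked in blast)+
  then have "tutte ?M 1 (1 :: int) \<le> tutte ?M 2 0"
    by (simp add: tutte_1_1[OF is_matroid_catalan_deleted] tutte_2_0_catalan_deleted)
  then show ?thesis by simp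
qed

end
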